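(* For $d\geq2$ and $k\geq1$, let $A^{[k]}_d$ be the adjacency matrix of the distance-$k$ graph of the $d$-regular tree. Then, for fixed $k$, the distribution with respect to the vacuum state of $d^{-k/2}A^{[k]}_d$ converges in moments as $d\to\infty$ to the distribution of $P_k(s)$, where $s$ is a random variable with the semicircle law.
   Context: The distance-$k$ graph of a graph has the same vertex set, with two vertices adjacent iff their graph distance is exactly $k$. For a fixed vertex $r$ of the tree, the vacuum state is $M\mapsto M_{rr}$, and the distribution of $M$ with respect to it is the probability measure with moments $(M^m)_{rr}$, $m\geq0$. $P_k$ is the Chebyshev polynomial defined by $P_0=1$, $P_1(x)=x$, $xP_n(x)=P_{n+1}(x)+P_{n-1}(x)$; the semicircle law has density $\frac{1}{2\pi}\sqrt{4-x^2}$ on $[-2,2]$. *)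

theory Defs
  imports
    "HOL-Probability.Probability"
    "HOL-Computational_Algebra.Polynomial"
    "Graph_Theory.Pair_Digraph"
    "Graph_Theory.Digraph_Component"
    "Graph_Theory.Shortest_Path"
begin

text \<open>
  Undirected simple graphs, possibly infinite, are symmetric loop-free pair digraphs.
  The predicate \<^const>\<open>Digraph_Component.tree\<close> cannot be used for these: it forbids every directed
  cycle, while each edge of a symmetric digraph yields a directed cycle of length 2, which is
  not a cycle of the undirected graph. In a simple graph, the directed cycles of length at least 3
  are precisely the (oriented) cycles of the undirected graph.
\<close>

definition undirected_tree :: "'a pair_pre_digraph \<Rightarrow> bool" where
  "undirected_tree G \<longleftrightarrow>
     pair_bidirected_digraph G \<and>
     Digraph_Component.connected (with_proj G) \<and>
     \<not> (\<exists>p. pre_digraph.cycle (with_proj G) p \<and> length p \<ge> 3)"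

definition regular_tree :: "nat \<Rightarrow> 'a pair_pre_digraph \<Rightarrow> bool" where
  "regular_tree d G \<longleftrightarrow>
     undirected_tree G \<and>
     (\<forall>v\<in>pverts G. finite (out_arcs (with_proj G) v) \<and> out_degree (with_proj G) v = d)"

definition graph_dist :: "'a pair_pre_digraph \<Rightarrow> 'a \<Rightarrow> 'a \<Rightarrow> ereal" where
  "graph_dist G u v = wf_digraph.\<mu> (with_proj G) (\<lambda>_. 1) u v"

definition distance_graph :: "nat \<Rightarrow> 'a pair_pre_digraph \<Rightarrow> 'a pair_pre_digraph" where
  "distance_graph k G =
     \<lparr> pverts = pverts G,
       parcs = {(u, v). u \<in> pverts G \<and> v \<in> pverts G \<and> graph_dist G u v = ereal (real k)} \<rparr>"

definition adjacency_matrix :: "'a pair_pre_digraph \<Rightarrow> 'a \<Rightarrow> 'a \<Rightarrow> real" where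
  "adjacency_matrix G u v = (if (u, v) \<in> parcs G then 1 else 0)"

text \<open>
  Real matrices with rows and columns indexed by a possibly infinite set \<open>V\<close>. For adjacency
  matrices of locally finite graphs, and their multiples and powers, all sums have only finitely
  many nonzero terms.
\<close>

definition matrix_times :: "'a set \<Rightarrow> ('a \<Rightarrow> 'a \<Rightarrow> real) \<Rightarrow> ('a \<Rightarrow> 'a \<Rightarrow> real) \<Rightarrow> 'a \<Rightarrow> 'a \<Rightarrow> real" where
  "matrix_times V M N u v = (\<Sum>\<^sub>\<infinity>w\<in>V. M u w * N w v)"

primrec matrix_power :: "'a set \<Rightarrow> ('a \<Rightarrow> 'a \<Rightarrow> real) \<Rightarrow> nat \<Rightarrow> 'a \<Rightarrow> 'a \<Rightarrow> real" where
  "matrix_power V M 0 = (\<lambda>u v. if u = v then 1 else 0)"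
| "matrix_power V M (Suc m) = matrix_times V M (matrix_power V M m)"

definition vacuum_state :: "'a \<Rightarrow> ('a \<Rightarrow> 'a \<Rightarrow> real) \<Rightarrow> real" where
  "vacuum_state r M = M r r"

text \<open>The moment sequence of the distribution of \<open>M\<close> with respect to the vacuum state at \<open>r\<close>.\<close>

definition vacuum_moments :: "'a set \<Rightarrow> 'a \<Rightarrow> ('a \<Rightarrow> 'a \<Rightarrow> real) \<Rightarrow> nat \<Rightarrow> real" where
  "vacuum_moments V r M m = vacuum_state r (matrix_power V M m)"

text \<open>
  Convergence in moments of a sequence of distributions, the \<open>n\<close>-th of which has the moment
  sequence \<open>c n\<close>, to a probability measure on the reals all of whose moments are finite.
\<close>

definition converges_in_moments :: "(nat \<Rightarrow> nat \<Rightarrow> real) \<Rightarrow> real measure \<Rightarrow> bool" where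
  "converges_in_moments c \<nu> \<longleftrightarrow>
     (\<forall>m. integrable \<nu> (\<lambda>x. x ^ m) \<and> (\<lambda>n. c n m) \<longlonglongrightarrow> (\<integral>x. x ^ m \<partial>\<nu>))"

fun chebyshev_P :: "nat \<Rightarrow> real poly" where
  "chebyshev_P 0 = 1"
| "chebyshev_P (Suc 0) = [:0, 1:]"
| "chebyshev_P (Suc (Suc n)) = [:0, 1:] * chebyshev_P (Suc n) - chebyshev_P n"

definition semicircle_density :: "real \<Rightarrow> real" where
  "semicircle_density x = (if x \<in> {-2..2} then sqrt (4 - x\<^sup>2) / (2 * pi) else 0)"

end

theory Submission
  imports Defs
begin

text \<open>
  In a tree, every vertex \<open>u \<noteq> v\<close> has exactly one neighbour closer to \<open>v\<close>, and all its other
  neighbours are farther from \<open>v\<close>. Hence the distance-\<open>k\<close> operator \<open>A\<^sub>k\<close> preserves the functions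
  that are radial around the root, and \<open>A\<^sub>1 A\<^sub>k = A\<^sub>k\<^sub>+\<^sub>1 + (d - 1) A\<^sub>k\<^sub>-\<^sub>1\<close> (with \<open>d\<close> in place of
  \<open>d - 1\<close> if \<open>k = 1\<close>). After normalisation, \<open>A\<^sub>1\<close> acts on radial functions by
  \<open>g \<mapsto> (j \<mapsto> g (j - 1) + (1 - 1/d) g (j + 1))\<close> for \<open>j \<ge> 1\<close>, and as \<open>d \<rightarrow> \<infinity>\<close> both recursions become
  that of the Chebyshev polynomials. For \<open>g j = E[p(s) P\<^sub>j(s)]\<close> the limiting operator is
  multiplication of \<open>p\<close> by \<open>P\<^sub>k\<close>. The root indicator is \<open>E[P\<^sub>j(s)]\<close> by orthogonality of the
  Chebyshev polynomials for the semicircle law, so the \<open>m\<close>-th moment tends to \<open>E[P\<^sub>k(s)\<^sup>m]\<close>.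
\<close>

section \<open>Distances in connected graphs\<close>

locale connected_pair_graph = pair_bidirected_digraph G for G :: "'a pair_pre_digraph" +
  assumes connected: "Digraph_Component.connected (with_proj G)"
begin

definition nbrs :: "'a \<Rightarrow> 'a set" where
  "nbrs u = {w. (u, w) \<in> parcs G}"

definition hops :: "'a \<Rightarrow> 'a \<Rightarrow> nat" where
  "hops u v = (LEAST n. \<exists>p. awalk u p v \<and> length p = n)"

definition hop_sphere :: "'a \<Rightarrow> nat \<Rightarrow> 'a set" where
  "hop_sphere u k = {x \<in> pverts G. hops u x = k}"

lemma nbrs_subset: "nbrs u \<subseteq> pverts G"
  by (auto simp: nbrs_def dest: in_arcsD2)

lemma nbrs_sym: "w \<in> nbrs u \<Longrightarrow> u \<in> nbrs w"
  by (auto simp: nbrs_def intro: arcs_symmetric)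

lemma nbrs_irrefl: "u \<notin> nbrs u"
  by (auto simp: nbrs_def dest: no_loops')

lemma hop_sphere_subset: "hop_sphere u k \<subseteq> pverts G"
  by (auto simp: hop_sphere_def)

lemma geodesic:
  assumes "u \<in> pverts G" "v \<in> pverts G"
  obtains p where "awalk u p v" "length p = hops u v"
proof -
  have "strongly_connected (with_proj G)"
    by (rule symmetric_connected_imp_strongly_connected[OF sym_arcs connected])
  then have "\<exists>n p. awalk u p v \<and> length p = n"
    using assms by (auto simp: reachable_awalk elim!: strongly_connectedE)
  then have "\<exists>p. awalk u p v \<and> length p = hops u v"
    unfolding hops_def by (rule LeastI_ex)
  then show ?thesis using that by blast
qed

lemma hops_le: "awalk u p v \<Longrightarrow> hops u v \<le> length p"
  unfolding hops_def by (rule Least_le) blast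

lemma graph_dist_eq_hops:
  assumes "u \<in> pverts G" "v \<in> pverts G"
  shows "graph_dist G u v = ereal (real (hops u v))"
proof -
  have cost: "awalk_cost (\<lambda>_. 1) p = real (length p)" for p :: "('a \<times> 'a) list"
    by (induct p) auto
  obtain p where p: "awalk u p v" "length p = hops u v"
    using geodesic[OF assms] .
  have "(INF p\<in>{p. awalk u p v}. ereal (awalk_cost (\<lambda>_. 1) p)) = ereal (real (hops u v))"
  proof (rule INF_eqI)
    show "ereal (real (hops u v)) \<le> ereal (awalk_cost (\<lambda>_. 1) q)" if "q \<in> {p. awalk u p v}" for q
      using that by (simp add: cost hops_le)
    show "y \<le> ereal (real (hops u v))"
      if "\<And>q. q \<in> {p. awalk u p v} \<Longrightarrow> y \<le> ereal (awalk_cost (\<lambda>_. 1) q)" for y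
      using that[of p] p by (simp add: cost)
  qed
  then show ?thesis
    by (simp add: graph_dist_def \<mu>_def)
qed

lemma adjacency_matrix_distance_graph:
  assumes "u \<in> pverts G"
  shows "adjacency_matrix (distance_graph k G) u v = indicator (hop_sphere u k) v"
  using assms
  by (auto simp: adjacency_matrix_def distance_graph_def graph_dist_eq_hops hop_sphere_def
      indicator_def)

lemma hops_eq_0_iff:
  assumes "u \<in> pverts G" "v \<in> pverts G"
  shows "hops u v = 0 \<longleftrightarrow> u = v"
proof
  obtain p where "awalk u p v" "length p = hops u v"
    using geodesic[OF assms] .
  then show "u = v" if "hops u v = 0"
    using that by (auto simp: awalk_Nil_iff)
  show "hops u v = 0" if "u = v"
    using hops_le[of u "[]" v] that assms by (simp add: awalk_Nil_iff)
qed

lemma hops_le_Suc_nbr: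
  assumes "w \<in> nbrs u" "v \<in> pverts G"
  shows "hops u v \<le> Suc (hops w v)"
proof -
  obtain p where "awalk w p v" "length p = hops w v"
    using geodesic[of w v] nbrs_subset assms by blast
  then show ?thesis
    using hops_le[of u "(u, w) # p" v] assms
    by (auto simp: awalk_Cons_iff nbrs_def)
qed

lemma geodesic_verts_closer:
  assumes "awalk u p v" "length p = hops u v" "x \<in> set (awalk_verts u p)" "x \<noteq> u"
  shows "hops x v < hops u v"
proof -
  obtain q s where qs: "p = q @ s" "awalk u q x" "awalk x s v"
    using awalk_decomp[OF assms(1,3)] by blast
  then have "q \<noteq> []"
    using assms(4) by (auto simp: awalk_Nil_iff)
  then have "length s < hops u v"
    using qs(1) assms(2) by (cases q) auto
  then show ?thesis
    using hops_le[OF qs(3)] by simp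
qed

lemma closer_nbr:
  assumes "u \<in> pverts G" "v \<in> pverts G" "u \<noteq> v"
  obtains w where "w \<in> nbrs u" "Suc (hops w v) = hops u v"
proof -
  obtain p where p: "awalk u p v" "length p = hops u v"
    using geodesic[OF assms(1,2)] .
  with assms(3) obtain w q where pq: "p = (u, w) # q"
    by (cases p) (auto simp: awalk_Nil_iff awalk_Cons_iff)
  then have w: "w \<in> nbrs u" and q: "awalk w q v"
    using p(1) by (auto simp: awalk_Cons_iff nbrs_def)
  have "Suc (hops w v) = hops u v"
    using hops_le[OF q] hops_le_Suc_nbr[OF w assms(2)] p(2) pq by simp
  with w show ?thesis by (rule that)
qed

lemma hop_sphere_0: "u \<in> pverts G \<Longrightarrow> hop_sphere u 0 = {u}"
  by (auto simp: hop_sphere_def hops_eq_0_iff)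

lemma hop_sphere_Suc_subset:
  assumes "u \<in> pverts G"
  shows "hop_sphere u (Suc k) \<subseteq> (\<Union>w\<in>nbrs u. hop_sphere w k)"
proof
  fix x assume "x \<in> hop_sphere u (Suc k)"
  then have x: "x \<in> pverts G" "hops u x = Suc k"
    by (auto simp: hop_sphere_def)
  then have "u \<noteq> x"
    using hops_eq_0_iff[of u x] assms by auto
  then obtain w where "w \<in> nbrs u" "Suc (hops w x) = hops u x"
    using closer_nbr[OF assms x(1)] by metis
  then show "x \<in> (\<Union>w\<in>nbrs u. hop_sphere w k)"
    using x by (auto simp: hop_sphere_def)
qed

lemma hop_sphere_1:
  assumes "u \<in> pverts G"
  shows "hop_sphere u (Suc 0) = nbrs u"
proof
  show "hop_sphere u (Suc 0) \<subseteq> nbrs u"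
    using hop_sphere_Suc_subset[OF assms, of 0] hop_sphere_0 nbrs_subset by fastforce
  show "nbrs u \<subseteq> hop_sphere u (Suc 0)"
  proof
    fix x assume x: "x \<in> nbrs u"
    then have vert: "x \<in> pverts G" and "u \<noteq> x"
      using nbrs_subset nbrs_irrefl by auto
    then show "x \<in> hop_sphere u (Suc 0)"
      using hops_le_Suc_nbr[OF x vert] hops_eq_0_iff[OF vert vert] hops_eq_0_iff[OF assms vert]
      by (simp add: hop_sphere_def)
  qed
qed

end

locale locally_finite_pair_graph = connected_pair_graph G for G :: "'a pair_pre_digraph" +
  assumes finite_nbrs: "u \<in> pverts G \<Longrightarrow> finite (nbrs u)"
begin

lemma finite_hop_sphere: "u \<in> pverts G \<Longrightarrow> finite (hop_sphere u k)"
proof (induct k arbitrary: u)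
  case 0
  then show ?case by (simp add: hop_sphere_0)
next
  case (Suc k)
  have "finite (\<Union>w\<in>nbrs u. hop_sphere w k)"
    using Suc nbrs_subset finite_nbrs by blast
  then show ?case
    by (rule finite_subset[OF hop_sphere_Suc_subset[OF Suc.prems]])
qed

lemma matrix_times_distance_graph:
  assumes "u \<in> pverts G"
  shows "matrix_times (pverts G) (\<lambda>u v. c * adjacency_matrix (distance_graph k G) u v) N u v =
    c * (\<Sum>w\<in>hop_sphere u k. N w v)"
proof -
  have "matrix_times (pverts G) (\<lambda>u v. c * adjacency_matrix (distance_graph k G) u v) N u v =
      (\<Sum>\<^sub>\<infinity>w\<in>hop_sphere u k. c * N w v)"
    unfolding matrix_times_def
    by (rule infsum_cong_neutral)
      (use hop_sphere_subset in \<open>auto simp: adjacency_matrix_distance_graph[OF assms]\<close>)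
  then show ?thesis
    using finite_hop_sphere[OF assms] by (simp add: sum_distrib_left)
qed

end

section \<open>Regular trees\<close>

locale pair_tree = connected_pair_graph G for G :: "'a pair_pre_digraph" +
  assumes cycle_length: "cycle p \<Longrightarrow> length p < 3"
begin

lemma awalk_between_nbrs_visits:
  assumes "w \<in> nbrs u" "w' \<in> nbrs u" "w \<noteq> w'" "awalk w p w'"
  shows "u \<in> set (awalk_verts w p)"
proof (rule ccontr)
  assume u_notin_p: "u \<notin> set (awalk_verts w p)"
  define q where "q = awalk_to_apath p"
  have q: "awalk w q w'" "distinct (awalk_verts w q)"
    using apath_awalk_to_apath[OF assms(4)] by (auto simp: q_def apath_def)
  have "set q \<subseteq> set p"
    using awalk_to_apath_subset[OF assms(4)] by (simp add: q_def)
  then have u_notin_q: "u \<notin> set (awalk_verts w q)"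
    using u_notin_p set_awalk_verts[OF q(1)] set_awalk_verts[OF assms(4)] by auto
  have closing: "awalk w' [(w', u)] u"
    using assms(2) nbrs_sym[OF assms(2)] nbrs_subset
    by (auto simp: awalk_simps nbrs_def)
  have return: "awalk w (q @ [(w', u)]) u"
    using q(1) closing by (rule awalk_appendI)
  have "awalk u ((u, w) # q @ [(w', u)]) u"
    using assms(1) return in_arcsD1 by (auto simp: awalk_Cons_iff nbrs_def)
  moreover have "awalk_verts w (q @ [(w', u)]) = awalk_verts w q @ [u]"
    using awalk_verts_append[OF return] q(1) by simp
  ultimately have "cycle ((u, w) # q @ [(w', u)])"
    using q(2) u_notin_q unfolding cycle_def by (intro exI[of _ u]) simp
  then have "q = []"
    using cycle_length by fastforce
  then show False
    using q(1) assms(3) by (simp add: awalk_Nil_iff)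
qed

lemma nonfarther_nbr_unique:
  assumes "v \<in> pverts G" "w \<in> nbrs u" "w' \<in> nbrs u"
    and "hops w v \<le> hops u v" "hops w' v \<le> hops u v"
  shows "w = w'"
proof (rule ccontr)
  assume "w \<noteq> w'"
  have avoid: "u \<notin> set (awalk_verts x p)"
    if "x \<in> nbrs u" "hops x v \<le> hops u v" "awalk x p v" "length p = hops x v" for x p
    using geodesic_verts_closer[OF that(3,4), of u] that(1,2) nbrs_irrefl by fastforce
  obtain p where p: "awalk w p v" "length p = hops w v"
    using geodesic[of w v] nbrs_subset assms(1,2) by blast
  obtain q where q: "awalk w' q v" "length q = hops w' v"
    using geodesic[of w' v] nbrs_subset assms(1,3) by blast
  have rev_q: "awalk v (rev_path q) w'"
    using q(1) by simp
  have "u \<in> set (awalk_verts w (p @ rev_path q))"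
    using awalk_between_nbrs_visits[OF assms(2,3) \<open>w \<noteq> w'\<close> awalk_appendI[OF p(1) rev_q]] .
  then have "u \<in> set (awalk_verts w p) \<union> set (awalk_verts w' q)"
    using set_awalk_verts_append[OF p(1) rev_q] awalk_verts_rev_path[OF q(1)] by simp
  then show False
    using avoid assms(2-5) p q by blast
qed

lemma hops_nbr:
  assumes "u \<in> pverts G" "v \<in> pverts G" "w \<in> nbrs u"
  shows "Suc (hops w v) = hops u v \<or> hops w v = Suc (hops u v)"
proof -
  have "hops w v \<noteq> hops u v"
  proof
    assume same: "hops w v = hops u v"
    then have "u \<noteq> v"
      using hops_eq_0_iff[OF assms(1,2)] hops_eq_0_iff[of w v] nbrs_irrefl nbrs_subset assms by auto
    then obtain x where "x \<in> nbrs u" "Suc (hops x v) = hops u v"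
      using closer_nbr[OF assms(1,2)] by blast
    then show False
      using nonfarther_nbr_unique[OF assms(2,3), of x] same by auto
  qed
  then show ?thesis
    using hops_le_Suc_nbr[OF assms(3,2)] hops_le_Suc_nbr[OF nbrs_sym[OF assms(3)] assms(2)]
    by linarith
qed

lemma hop_sphere_nbr_subset:
  assumes "u \<in> pverts G" "w \<in> nbrs u"
  shows "hop_sphere w (Suc k) \<subseteq> hop_sphere u (Suc (Suc k)) \<union> hop_sphere u k"
proof
  fix x assume "x \<in> hop_sphere w (Suc k)"
  then have x: "x \<in> pverts G" "hops w x = Suc k"
    by (auto simp: hop_sphere_def)
  then show "x \<in> hop_sphere u (Suc (Suc k)) \<union> hop_sphere u k"
    using hops_nbr[OF assms(1) x(1) assms(2)] by (auto simp: hop_sphere_def)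
qed

end

text \<open>In the \<open>d\<close>-regular tree, a vertex at distance \<open>j\<close> from \<open>v\<close> has \<open>branching d j\<close> neighbours
  farther from \<open>v\<close>.\<close>

definition branching :: "nat \<Rightarrow> nat \<Rightarrow> nat" where
  "branching d j = (if j = 0 then d else d - 1)"

locale regular_pair_tree = pair_tree G + locally_finite_pair_graph G
  for G :: "'a pair_pre_digraph" +
  fixes d :: nat
  assumes card_nbrs: "u \<in> pverts G \<Longrightarrow> card (nbrs u) = d"
begin

lemma sum_nbrs_hops:
  fixes \<phi> :: "nat \<Rightarrow> 'b :: semiring_1"
  assumes "u \<in> pverts G" "v \<in> pverts G"
  shows "(\<Sum>w\<in>nbrs u. \<phi> (hops w v)) =
    (if u = v then 0 else \<phi> (hops u v - 1)) +
    of_nat (branching d (hops u v)) * \<phi> (Suc (hops u v))"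
proof (cases "u = v")
  case True
  then have "hops w v = Suc 0" if "w \<in> nbrs u" for w
    using hops_nbr[OF assms that] hops_eq_0_iff[OF assms] by auto
  then show ?thesis
    using True hops_eq_0_iff[OF assms] card_nbrs[OF assms(1)] by (simp add: branching_def)
next
  case False
  then obtain w where w: "w \<in> nbrs u" "Suc (hops w v) = hops u v"
    using closer_nbr[OF assms] by blast
  have farther: "hops x v = Suc (hops u v)" if "x \<in> nbrs u - {w}" for x
    using hops_nbr[OF assms, of x] nonfarther_nbr_unique[OF assms(2) w(1), of x] w(2) that
    by auto
  have "(\<Sum>x\<in>nbrs u. \<phi> (hops x v)) = \<phi> (hops w v) + (\<Sum>x\<in>nbrs u - {w}. \<phi> (hops x v))"
    by (rule sum.remove[OF finite_nbrs[OF assms(1)] w(1)])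
  also have "(\<Sum>x\<in>nbrs u - {w}. \<phi> (hops x v)) = of_nat (d - 1) * \<phi> (Suc (hops u v))"
    using farther w(1) card_nbrs[OF assms(1)] by simp
  also have "hops w v = hops u v - 1"
    using w(2) by simp
  finally show ?thesis
    using False hops_eq_0_iff[OF assms] by (simp add: branching_def)
qed

lemma card_nbrs_hops_eq:
  assumes "u \<in> pverts G" "v \<in> pverts G"
  shows "card {w \<in> nbrs u. hops w v = n} =
    of_bool (u \<noteq> v \<and> hops u v - 1 = n) +
    branching d (hops u v) * of_bool (Suc (hops u v) = n)"
proof -
  have "card {w \<in> nbrs u. hops w v = n} = (\<Sum>w\<in>nbrs u. of_bool (hops w v = n))"
    using finite_nbrs[OF assms(1)] by (simp add: Int_def)
  then show ?thesis
    using sum_nbrs_hops[OF assms, of "\<lambda>j. of_bool (j = n) :: nat"] by simp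
qed

lemma sum_nbrs_hop_sphere:
  fixes f :: "'a \<Rightarrow> 'b :: comm_semiring_1"
  assumes "u \<in> pverts G"
  shows "(\<Sum>w\<in>nbrs u. \<Sum>x\<in>hop_sphere w (Suc k). f x) =
    (\<Sum>x\<in>hop_sphere u (Suc (Suc k)). f x) +
    of_nat (branching d k) * (\<Sum>x\<in>hop_sphere u k. f x)"
proof -
  define X where "X = hop_sphere u (Suc (Suc k)) \<union> hop_sphere u k"
  define N where "N x = {w \<in> nbrs u. hops w x = Suc k}" for x
  have finite_X: "finite X"
    using finite_hop_sphere[OF assms] by (simp add: X_def)
  have "hop_sphere w (Suc k) = {x \<in> X. hops w x = Suc k}" if "w \<in> nbrs u" for w
    using hop_sphere_nbr_subset[OF assms that, of k] by (auto simp: X_def hop_sphere_def)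
  then have "(\<Sum>w\<in>nbrs u. \<Sum>x\<in>hop_sphere w (Suc k). f x) =
      (\<Sum>w\<in>nbrs u. \<Sum>x | x \<in> X \<and> hops w x = Suc k. f x)"
    by simp
  also have "\<dots> = (\<Sum>x\<in>X. of_nat (card (N x)) * f x)"
    by (simp add: sum.swap_restrict[OF finite_nbrs[OF assms] finite_X] N_def)
  also have "\<dots> = (\<Sum>x\<in>hop_sphere u (Suc (Suc k)). of_nat (card (N x)) * f x) +
      (\<Sum>x\<in>hop_sphere u k. of_nat (card (N x)) * f x)"
    unfolding X_def using finite_hop_sphere[OF assms]
    by (intro sum.union_disjoint) (auto simp: hop_sphere_def)
  also have "(\<Sum>x\<in>hop_sphere u (Suc (Suc k)). of_nat (card (N x)) * f x) =
      (\<Sum>x\<in>hop_sphere u (Suc (Suc k)). f x)"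
    using hops_eq_0_iff[OF assms assms]
    by (intro sum.cong) (auto simp: N_def hop_sphere_def card_nbrs_hops_eq[OF assms])
  also have "(\<Sum>x\<in>hop_sphere u k. of_nat (card (N x)) * f x) =
      of_nat (branching d k) * (\<Sum>x\<in>hop_sphere u k. f x)"
    unfolding sum_distrib_left
    by (intro sum.cong) (auto simp: N_def hop_sphere_def card_nbrs_hops_eq[OF assms])
  finally show ?thesis .
qed

end

lemma regular_tree_imp_regular_pair_tree:
  assumes "regular_tree d G"
  shows "regular_pair_tree G d"
proof -
  interpret pair_bidirected_digraph G
    using assms by (simp add: regular_tree_def undirected_tree_def)
  interpret pair_tree G
    using assms by unfold_locales (auto simp: regular_tree_def undirected_tree_def not_le)
  have out_arcs_eq: "out_arcs (with_proj G) u = Pair u ` nbrs u" for u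
    by (auto simp: nbrs_def)
  have inj_Pair: "inj_on (Pair u) (nbrs u)" for u
    by (simp add: inj_on_def)
  show ?thesis
    using assms
    by unfold_locales
      (auto simp: regular_tree_def out_degree_def out_arcs_eq card_image[OF inj_Pair]
        finite_image_iff[OF inj_Pair])
qed

section \<open>The action on radial functions\<close>

definition branching_weight :: "real \<Rightarrow> nat \<Rightarrow> real" where
  "branching_weight q j = (if j = 0 then 1 else q)"

lemma real_branching:
  "d > 0 \<Longrightarrow> real (branching d j) = real d * branching_weight (1 - 1 / real d) j"
  by (simp add: branching_def branching_weight_def right_diff_distrib of_nat_diff)

definition radial_adjacency_op :: "real \<Rightarrow> (nat \<Rightarrow> real) \<Rightarrow> nat \<Rightarrow> real" where
  "radial_adjacency_op q g j = (if j = 0 then 0 else g (j - 1)) + branching_weight q j * g (Suc j)"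

fun radial_distance_op :: "real \<Rightarrow> nat \<Rightarrow> (nat \<Rightarrow> real) \<Rightarrow> nat \<Rightarrow> real" where
  "radial_distance_op q 0 g = g"
| "radial_distance_op q (Suc 0) g = radial_adjacency_op q g"
| "radial_distance_op q (Suc (Suc k)) g =
     (\<lambda>j. radial_adjacency_op q (radial_distance_op q (Suc k) g) j -
       branching_weight q k * radial_distance_op q k g j)"

lemma tendsto_branching_weight:
  "q \<longlonglongrightarrow> q\<^sub>0 \<Longrightarrow> (\<lambda>n. branching_weight (q n) j) \<longlonglongrightarrow> branching_weight q\<^sub>0 j"
  by (simp add: branching_weight_def)

lemma tendsto_radial_adjacency_op:
  assumes "q \<longlonglongrightarrow> q\<^sub>0" "\<And>j. (\<lambda>n. g n j) \<longlonglongrightarrow> h j"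
  shows "(\<lambda>n. radial_adjacency_op (q n) (g n) j) \<longlonglongrightarrow> radial_adjacency_op q\<^sub>0 h j"
  unfolding radial_adjacency_op_def
  using assms by (auto intro!: tendsto_intros tendsto_branching_weight)

lemma tendsto_radial_distance_op:
  assumes "q \<longlonglongrightarrow> q\<^sub>0" "\<And>j. (\<lambda>n. g n j) \<longlonglongrightarrow> h j"
  shows "(\<lambda>n. radial_distance_op (q n) k (g n) j) \<longlonglongrightarrow> radial_distance_op q\<^sub>0 k h j"
proof (induct k arbitrary: j rule: induct_nat_012)
  case 0
  then show ?case by (simp add: assms(2))
next
  case 1
  then show ?case by (simp add: tendsto_radial_adjacency_op assms)
next
  case (ge2 k)
  then show ?case
    by (auto intro!: tendsto_intros tendsto_branching_weight tendsto_radial_adjacency_op assms(1))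
qed

lemma tendsto_radial_distance_op_funpow:
  assumes "q \<longlonglongrightarrow> q\<^sub>0"
  shows "(\<lambda>n. (radial_distance_op (q n) k ^^ m) g j) \<longlonglongrightarrow> (radial_distance_op q\<^sub>0 k ^^ m) g j"
  by (induct m arbitrary: j) (auto intro: tendsto_radial_distance_op[OF assms])

definition normalized_distance_matrix ::
  "nat \<Rightarrow> nat \<Rightarrow> 'a pair_pre_digraph \<Rightarrow> 'a \<Rightarrow> 'a \<Rightarrow> real" where
  "normalized_distance_matrix d k G =
     (\<lambda>u v. real d powr (- (real k / 2)) * adjacency_matrix (distance_graph k G) u v)"

context regular_pair_tree
begin

definition sphere_op :: "nat \<Rightarrow> ('a \<Rightarrow> real) \<Rightarrow> 'a \<Rightarrow> real" where
  "sphere_op k f u = (\<Sum>x\<in>hop_sphere u k. f x) / sqrt d ^ k"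

text \<open>The weights \<open>(sqrt d) ^ -hops u r\<close> normalise the radial functions so that the coefficients
  of \<^const>\<open>radial_adjacency_op\<close> converge as \<open>d\<close> grows.\<close>

definition radial :: "'a \<Rightarrow> (nat \<Rightarrow> real) \<Rightarrow> 'a \<Rightarrow> real" where
  "radial r g u = g (hops u r) / sqrt d ^ hops u r"

lemma sphere_op_0: "u \<in> pverts G \<Longrightarrow> sphere_op 0 f u = f u"
  by (simp add: sphere_op_def hop_sphere_0)

lemma sphere_op_cong:
  "(\<And>x. x \<in> pverts G \<Longrightarrow> f x = g x) \<Longrightarrow> sphere_op k f u = sphere_op k g u"
  unfolding sphere_op_def using hop_sphere_subset
  by (intro arg_cong2[of _ _ _ _ "(/)"] sum.cong) auto

lemma sphere_op_recurrence:
  assumes "d > 0" "u \<in> pverts G"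
  shows "sphere_op (Suc (Suc k)) f u =
    sphere_op (Suc 0) (sphere_op (Suc k) f) u
    - branching_weight (1 - 1 / real d) k * sphere_op k f u"
proof -
  have "sphere_op (Suc 0) (sphere_op (Suc k) f) u =
      (\<Sum>w\<in>nbrs u. \<Sum>x\<in>hop_sphere w (Suc k). f x) / sqrt d ^ Suc (Suc k)"
    by (simp add: sphere_op_def hop_sphere_1[OF assms(2)] sum_divide_distrib mult_ac)
  also have "\<dots> = sphere_op (Suc (Suc k)) f u +
      real d * branching_weight (1 - 1 / real d) k * (\<Sum>x\<in>hop_sphere u k. f x) /
        sqrt d ^ Suc (Suc k)"
    by (simp only: sum_nbrs_hop_sphere[OF assms(2)] real_branching[OF assms(1)] add_divide_distrib
        sphere_op_def)
  also have "sqrt d ^ Suc (Suc k) = real d * sqrt d ^ k"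
    by simp
  finally show ?thesis
    using assms(1) by (simp add: sphere_op_def)
qed

lemma sphere_op_1_radial:
  assumes "d > 0" "r \<in> pverts G" "u \<in> pverts G"
  shows "sphere_op (Suc 0) (radial r g) u = radial r (radial_adjacency_op (1 - 1 / real d) g) u"
proof -
  define a where "a = sqrt d"
  define q where "q = 1 - 1 / real d"
  define h where "h = hops u r"
  have "a > 0"
    using assms(1) by (simp add: a_def)
  have "(\<Sum>w\<in>nbrs u. radial r g w) = (if h = 0 then 0 else g (h - 1) / a ^ (h - 1)) +
      a * a * branching_weight q h * (g (Suc h) / a ^ Suc h)"
    using sum_nbrs_hops[OF assms(3,2), of "\<lambda>j. g j / a ^ j"] hops_eq_0_iff[OF assms(3,2)]
    by (simp add: radial_def h_def a_def q_def real_branching[OF assms(1)])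
  also have "\<dots> = a * (radial_adjacency_op q g h / a ^ h)"
    using \<open>a > 0\<close> by (cases h) (simp_all add: radial_adjacency_op_def field_simps)
  finally show ?thesis
    using \<open>a > 0\<close>
    by (simp add: sphere_op_def hop_sphere_1[OF assms(3)] radial_def h_def a_def q_def)
qed

lemma sphere_op_radial:
  assumes "d > 0" "r \<in> pverts G" "u \<in> pverts G"
  shows "sphere_op k (radial r g) u = radial r (radial_distance_op (1 - 1 / real d) k g) u"
  using assms(3)
proof (induct k arbitrary: u rule: induct_nat_012)
  case 0
  then show ?case by (simp add: sphere_op_0)
next
  case 1
  then show ?case by (simp add: sphere_op_1_radial[OF assms(1,2)])
next
  case (ge2 k)
  define q where "q = 1 - 1 / real d"
  have "sphere_op (Suc 0) (sphere_op (Suc k) (radial r g)) u =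
      sphere_op (Suc 0) (radial r (radial_distance_op q (Suc k) g)) u"
    using ge2.hyps(2) by (intro sphere_op_cong) (simp add: q_def)
  also have "\<dots> = radial r (radial_adjacency_op q (radial_distance_op q (Suc k) g)) u"
    unfolding q_def by (rule sphere_op_1_radial[OF assms(1,2) ge2.prems])
  finally have "sphere_op (Suc (Suc k)) (radial r g) u =
      radial r (radial_adjacency_op q (radial_distance_op q (Suc k) g)) u -
      branching_weight q k * radial r (radial_distance_op q k g) u"
    unfolding q_def sphere_op_recurrence[OF assms(1) ge2.prems] ge2.hyps(1)[OF ge2.prems]
    by (rule arg_cong)
  then show ?case
    by (simp add: q_def radial_def[of r _ u] diff_divide_distrib)
qed

lemma matrix_times_normalized_distance_matrix:
  assumes "d > 0" "u \<in> pverts G"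
  shows "matrix_times (pverts G) (normalized_distance_matrix d k G) N u v =
    sphere_op k (\<lambda>w. N w v) u"
proof -
  have "real d powr (- (real k / 2)) = 1 / sqrt d ^ k"
    using assms(1)
    by (simp add: powr_minus_divide powr_half_sqrt[symmetric] powr_realpow[symmetric] powr_powr)
  then show ?thesis
    unfolding normalized_distance_matrix_def matrix_times_distance_graph[OF assms(2)]
    by (simp add: sphere_op_def)
qed

lemma matrix_power_normalized_distance_matrix:
  assumes "d > 0" "r \<in> pverts G" "u \<in> pverts G"
  shows "matrix_power (pverts G) (normalized_distance_matrix d k G) m u r =
    radial r ((radial_distance_op (1 - 1 / real d) k ^^ m) (\<lambda>j. of_bool (j = 0))) u"
  using assms(3)
proof (induct m arbitrary: u)
  case 0
  then show ?case
    using hops_eq_0_iff[OF 0 assms(2)] by (cases "u = r") (auto simp: radial_def)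
next
  case (Suc m)
  define g where "g = (radial_distance_op (1 - 1 / real d) k ^^ m) (\<lambda>j. of_bool (j = 0))"
  have "matrix_power (pverts G) (normalized_distance_matrix d k G) (Suc m) u r =
      sphere_op k (\<lambda>w. matrix_power (pverts G) (normalized_distance_matrix d k G) m w r) u"
    by (simp add: matrix_times_normalized_distance_matrix[OF assms(1) Suc.prems])
  also have "\<dots> = sphere_op k (radial r g) u"
    by (rule sphere_op_cong) (simp add: Suc.hyps g_def)
  also have "\<dots> = radial r (radial_distance_op (1 - 1 / real d) k g) u"
    by (rule sphere_op_radial[OF assms(1,2) Suc.prems])
  finally show ?case by (simp add: g_def)
qed

end

lemma vacuum_moments_normalized_distance_matrix:
  assumes "regular_tree d G" "d > 0" "r \<in> pverts G"
  shows "vacuum_moments (pverts G) r (normalized_distance_matrix d k G) m =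
    (radial_distance_op (1 - 1 / real d) k ^^ m) (\<lambda>j. of_bool (j = 0)) 0"
proof -
  interpret regular_pair_tree G d
    using assms(1) by (rule regular_tree_imp_regular_pair_tree)
  show ?thesis
    using matrix_power_normalized_distance_matrix[OF assms(2,3,3), of k m] hops_eq_0_iff[OF assms(3,3)]
    by (simp add: vacuum_moments_def vacuum_state_def radial_def)
qed

lemma tendsto_vacuum_moments_normalized_distance_matrix:
  assumes "\<And>d. d \<ge> 2 \<Longrightarrow> regular_tree d (T d)" "\<And>d. d \<ge> 2 \<Longrightarrow> r d \<in> pverts (T d)"
  shows "(\<lambda>d. vacuum_moments (pverts (T d)) (r d) (normalized_distance_matrix d k (T d)) m)
    \<longlonglongrightarrow> (radial_distance_op 1 k ^^ m) (\<lambda>j. of_bool (j = 0)) 0"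
proof -
  have "(\<lambda>d. 1 - 1 / real d) \<longlonglongrightarrow> 1 - 0"
    by (intro tendsto_intros lim_1_over_n)
  then have "(\<lambda>d. (radial_distance_op (1 - 1 / real d) k ^^ m) (\<lambda>j. of_bool (j = 0)) 0)
      \<longlonglongrightarrow> (radial_distance_op 1 k ^^ m) (\<lambda>j. of_bool (j = 0)) 0"
    by (intro tendsto_radial_distance_op_funpow) simp
  then show ?thesis
  proof (rule Lim_transform_eventually)
    show "\<forall>\<^sub>F d in sequentially.
        (radial_distance_op (1 - 1 / real d) k ^^ m) (\<lambda>j. of_bool (j = 0)) 0 =
        vacuum_moments (pverts (T d)) (r d) (normalized_distance_matrix d k (T d)) m"
      using eventually_ge_at_top[of 2]
      by eventually_elim (simp add: vacuum_moments_normalized_distance_matrix assms)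
  qed
qed

section \<open>Chebyshev polynomials\<close>

lemma radial_adjacency_op_chebyshev_P:
  assumes "Modules.additive L"
  shows "radial_adjacency_op 1 (\<lambda>j. L (p * chebyshev_P j)) j = L (p * [:0, 1:] * chebyshev_P j)"
proof (cases j)
  case 0
  then show ?thesis by (simp add: radial_adjacency_op_def branching_weight_def)
next
  case (Suc i)
  have "p * [:0, 1:] * chebyshev_P (Suc i) = p * chebyshev_P i + p * chebyshev_P (Suc (Suc i))"
    by (simp only: chebyshev_P.simps algebra_simps)
  then show ?thesis
    by (simp add: Suc radial_adjacency_op_def branching_weight_def Modules.additive.add[OF assms]
        del: chebyshev_P.simps mult_pCons_left mult_pCons_right)
qed

lemma radial_distance_op_chebyshev_P:
  assumes "Modules.additive L"
  shows "radial_distance_op 1 k (\<lambda>j. L (p * chebyshev_P j)) =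
    (\<lambda>j. L (p * chebyshev_P k * chebyshev_P j))"
proof (induct k rule: induct_nat_012)
  case 0
  then show ?case by simp
next
  case 1
  then show ?case
    by (simp only: radial_distance_op.simps radial_adjacency_op_chebyshev_P[OF assms]
        chebyshev_P.simps fun_eq_iff) simp
next
  case (ge2 k)
  have "p * chebyshev_P (Suc k) * [:0, 1:] * chebyshev_P j - p * chebyshev_P k * chebyshev_P j =
      p * chebyshev_P (Suc (Suc k)) * chebyshev_P j" for j
    by (simp only: chebyshev_P.simps) (simp only: algebra_simps)
  then show ?case
    by (simp only: radial_distance_op.simps ge2 radial_adjacency_op_chebyshev_P[OF assms]
        branching_weight_def if_cancel mult_1_left Modules.additive.diff[OF assms, symmetric])
qed

lemma radial_distance_op_funpow_chebyshev_P:
  assumes "Modules.additive L" "\<And>j. L (chebyshev_P j) = of_bool (j = 0)"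
  shows "(radial_distance_op 1 k ^^ m) (\<lambda>j. of_bool (j = 0)) =
    (\<lambda>j. L (chebyshev_P k ^ m * chebyshev_P j))"
proof (induct m)
  case 0
  then show ?case by (simp add: assms(2))
next
  case (Suc m)
  then show ?case
    by (simp only: funpow.simps o_apply radial_distance_op_chebyshev_P[OF assms(1)] power_Suc2)
qed

lemma poly_chebyshev_P_cos_times_sin:
  "poly (chebyshev_P n) (2 * cos t) * sin t = sin (real (Suc n) * t)"
proof (induct n rule: induct_nat_012)
  case 0
  then show ?case by simp
next
  case 1
  then show ?case by (simp add: sin_double)
next
  case (ge2 n)
  have "sin (real (Suc (Suc n)) * t + t) + sin (real (Suc (Suc n)) * t - t) =
      2 * cos t * sin (real (Suc (Suc n)) * t)"
    by (simp add: sin_add sin_diff)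
  moreover have "real (Suc (Suc n)) * t + t = real (Suc (Suc (Suc n))) * t"
    and "real (Suc (Suc n)) * t - t = real (Suc n) * t"
    by (simp_all add: algebra_simps)
  ultimately have "sin (real (Suc (Suc (Suc n))) * t) =
      2 * cos t * sin (real (Suc (Suc n)) * t) - sin (real (Suc n) * t)"
    by simp
  also have "\<dots> = poly (chebyshev_P (Suc (Suc n))) (2 * cos t) * sin t"
    by (simp only: ge2[symmetric] chebyshev_P.simps poly_diff poly_mult left_diff_distrib) simp
  finally show ?case by simp
qed

lemma has_integral_sqrt_substitution:
  fixes f :: "real \<Rightarrow> real"
  assumes "continuous_on {-2..2} f"
  shows "((\<lambda>t. (2 * sin t)\<^sup>2 * f (2 * cos t)) has_integral
    integral {-2..2} (\<lambda>x. sqrt (4 - x\<^sup>2) * f x)) {0..pi}"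
proof -
  define F where "F = (\<lambda>x. sqrt (4 - x\<^sup>2) * f x)"
  have "((\<lambda>t. (- 2 * sin t) *\<^sub>R F (2 * cos t)) has_integral
      integral {2 * cos 0..2 * cos pi} F - integral {2 * cos pi..2 * cos 0} F) {0..pi}"
    unfolding F_def
    by (rule has_integral_substitution_general[where s = "{}" and c = "-2" and d = 2])
      (auto intro!: continuous_intros derivative_eq_intros assms)
  then have substituted:
    "((\<lambda>t. 2 * sin t * F (2 * cos t)) has_integral integral {-2..2} F) {0..pi}"
    by (auto dest: has_integral_neg)
  have "2 * sin t * F (2 * cos t) = (2 * sin t)\<^sup>2 * f (2 * cos t)" if "t \<in> {0..pi}" for t
  proof -
    have "(2 * sin t)\<^sup>2 = 4 - (2 * cos t)\<^sup>2"
      by (simp add: power_mult_distrib sin_squared_eq)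
    then have "sqrt (4 - (2 * cos t)\<^sup>2) = 2 * sin t"
      using that by (intro real_sqrt_unique) (simp_all add: sin_ge_zero)
    then show ?thesis
      by (simp only: F_def power2_eq_square mult.assoc)
  qed
  from has_integral_eq[OF this substituted] show ?thesis
    by (simp only: F_def)
qed

lemma has_integral_cos_of_int_mult:
  "((\<lambda>t. cos (of_int n * t)) has_integral (if n = 0 then pi else 0)) {0..pi}"
proof (cases "n = 0")
  case True
  then show ?thesis
    using has_integral_const_real[of "1 :: real" 0 pi] by simp
next
  case False
  have "((\<lambda>t. cos (of_int n * t)) has_integral
      sin (of_int n * pi) / of_int n - sin (of_int n * 0) / of_int n) {0..pi}"
    using False
    by (intro fundamental_theorem_of_calculus)
      (auto simp: has_real_derivative_iff_has_vector_derivative[symmetric]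
        intro!: derivative_eq_intros)
  then show ?thesis
    using False sin_times_pi_eq_0[of "of_int n"] by simp
qed

lemma chebyshev_P_orthogonal:
  "integral {-2..2} (\<lambda>x. sqrt (4 - x\<^sup>2) * (poly (chebyshev_P m) x * poly (chebyshev_P n) x)) =
    (if m = n then 2 * pi else 0)"
    (is "integral _ (\<lambda>x. _ * ?PP x) = _")
proof -
  have product: "(2 * sin t)\<^sup>2 * ?PP (2 * cos t) =
      2 * (cos (of_int (int m - int n) * t) - cos (of_int (int m + int n + 2) * t))" for t
  proof -
    have "(2 * sin t)\<^sup>2 * ?PP (2 * cos t) = 4 * (sin (real (Suc m) * t) * sin (real (Suc n) * t))"
      unfolding poly_chebyshev_P_cos_times_sin[symmetric] by (simp add: power2_eq_square)
    also have "\<dots> = 2 * (cos (real (Suc m) * t - real (Suc n) * t) -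
        cos (real (Suc m) * t + real (Suc n) * t))"
      by (simp add: sin_times_sin)
    finally show ?thesis
      by (simp add: algebra_simps)
  qed
  have "((\<lambda>t. (2 * sin t)\<^sup>2 * ?PP (2 * cos t)) has_integral
      integral {-2..2} (\<lambda>x. sqrt (4 - x\<^sup>2) * ?PP x)) {0..pi}"
    by (intro has_integral_sqrt_substitution continuous_intros)
  moreover have "((\<lambda>t. (2 * sin t)\<^sup>2 * ?PP (2 * cos t)) has_integral
      2 * ((if int m - int n = 0 then pi else 0) - (if int m + int n + 2 = 0 then pi else 0))) {0..pi}"
    unfolding product
    by (intro has_integral_mult_right has_integral_diff has_integral_cos_of_int_mult)
  ultimately show ?thesis
    by (auto dest: has_integral_unique)
qed

section \<open>The semicircle law\<close>

lemma semicircle_density_nonneg: "0 \<le> semicircle_density x"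
  using abs_le_square_iff[of x 2] by (auto simp: semicircle_density_def abs_le_iff)

locale semicircular = prob_space \<Omega> for \<Omega> :: "'b measure" +
  fixes s :: "'b \<Rightarrow> real"
  assumes semicircle_distributed: "distributed \<Omega> lborel s (\<lambda>x. ennreal (semicircle_density x))"
begin

lemma borel_measurable_continuous_comp:
  fixes f :: "real \<Rightarrow> real"
  assumes "continuous_on UNIV f"
  shows "(\<lambda>\<omega>. f (s \<omega>)) \<in> borel_measurable \<Omega>"
  using borel_measurable_continuous_onI[OF assms] distributed_measurable[OF semicircle_distributed]
  by (simp add: measurable_compose[of s])

lemma integrable_continuous_comp:
  fixes f :: "real \<Rightarrow> real"
  assumes "continuous_on UNIV f"
  shows "integrable \<Omega> (\<lambda>\<omega>. f (s \<omega>))"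
proof -
  have "compact (f ` {-2..2})"
    by (intro compact_continuous_image continuous_on_subset[OF assms]) auto
  then obtain B where B: "\<And>x. x \<in> {-2..2} \<Longrightarrow> norm (f x) \<le> B"
    using compact_imp_bounded[of "f ` {-2..2}"] unfolding bounded_iff by blast
  have "AE x in lborel. 0 < ennreal (semicircle_density x) \<longrightarrow> x \<in> {-2..2}"
    by (auto simp: semicircle_density_def)
  then have "AE \<omega> in \<Omega>. s \<omega> \<in> {-2..2}"
    by (subst distributed_AE2[OF semicircle_distributed]) auto
  then have "AE \<omega> in \<Omega>. norm (f (s \<omega>)) \<le> B"
    by eventually_elim (rule B)
  then show ?thesis
    by (rule integrable_const_bound) (rule borel_measurable_continuous_comp[OF assms])
qed

lemma expectation_continuous_comp:
  fixes f :: "real \<Rightarrow> real"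
  assumes "continuous_on UNIV f"
  shows "expectation (\<lambda>\<omega>. f (s \<omega>)) = integral {-2..2} (\<lambda>x. sqrt (4 - x\<^sup>2) * f x) / (2 * pi)"
proof -
  define F where "F = (\<lambda>x. sqrt (4 - x\<^sup>2) * f x)"
  have integrable_F: "set_integrable lborel {-2..2} F"
    unfolding F_def
    by (intro borel_integrable_atLeastAtMost' continuous_intros continuous_on_subset[OF assms]) auto
  have "expectation (\<lambda>\<omega>. f (s \<omega>)) = (\<integral>x. semicircle_density x * f x \<partial>lborel)"
    using borel_measurable_continuous_onI[OF assms]
    by (intro distributed_integral[OF semicircle_distributed, symmetric])
      (simp_all add: semicircle_density_nonneg)
  also have "\<dots> = (\<integral>x. (indicator {-2..2} x *\<^sub>R F x) / (2 * pi) \<partial>lborel)"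
    by (rule Bochner_Integration.integral_cong)
      (auto simp: semicircle_density_def F_def indicator_def)
  also have "\<dots> = integral {-2..2} F / (2 * pi)"
    using set_borel_integral_eq_integral(2)[OF integrable_F] by (simp add: set_lebesgue_integral_def)
  finally show ?thesis by (simp add: F_def)
qed

lemma additive_expectation_poly: "Modules.additive (\<lambda>p. expectation (\<lambda>\<omega>. poly p (s \<omega>)))"
  by unfold_locales (simp add: integrable_continuous_comp continuous_intros)

lemma expectation_chebyshev_P:
  "expectation (\<lambda>\<omega>. poly (chebyshev_P n) (s \<omega>)) = of_bool (n = 0)"
  using chebyshev_P_orthogonal[of 0 n]
  by (simp add: expectation_continuous_comp continuous_intros)

lemma expectation_chebyshev_P_power:
  "expectation (\<lambda>\<omega>. poly (chebyshev_P k) (s \<omega>) ^ m) =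
    (radial_distance_op 1 k ^^ m) (\<lambda>j. of_bool (j = 0)) 0"
  by (simp add: poly_power
      radial_distance_op_funpow_chebyshev_P[OF additive_expectation_poly expectation_chebyshev_P])

end

section \<open>Convergence in moments\<close>

lemma converges_in_moments_distrI:
  assumes X: "X \<in> borel_measurable M"
    and "\<And>m. integrable M (\<lambda>\<omega>. X \<omega> ^ m)"
    and "\<And>m. (\<lambda>n. c n m) \<longlonglongrightarrow> (\<integral>\<omega>. X \<omega> ^ m \<partial>M)"
  shows "converges_in_moments c (distr M borel X)"
  using assms(2,3)
  by (simp add: converges_in_moments_def integrable_distr_eq[OF X] integral_distr[OF X])

theorem theorem3p2:
  fixes T :: "nat \<Rightarrow> 'a pair_pre_digraph"
    and r :: "nat \<Rightarrow> 'a"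
    and k :: nat
    and \<Omega> :: "'b measure"
    and s :: "'b \<Rightarrow> real"
  assumes "\<And>d. d \<ge> 2 \<Longrightarrow> regular_tree d (T d)"
    and "\<And>d. d \<ge> 2 \<Longrightarrow> r d \<in> pverts (T d)"
    and "k \<ge> 1"
    and "prob_space \<Omega>"
    and "distributed \<Omega> lborel s (\<lambda>x. ennreal (semicircle_density x))"
  shows "converges_in_moments
           (\<lambda>d. vacuum_moments (pverts (T d)) (r d)
              (\<lambda>u v. real d powr (- (real k / 2)) * adjacency_matrix (distance_graph k (T d)) u v))
           (distr \<Omega> borel (\<lambda>\<omega>. poly (chebyshev_P k) (s \<omega>)))"
proof -
  interpret semicircular \<Omega> s
    using assms(4,5) by (simp add: semicircular_def semicircular_axioms_def)
  have "converges_in_moments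
      (\<lambda>d. vacuum_moments (pverts (T d)) (r d) (normalized_distance_matrix d k (T d)))
      (distr \<Omega> borel (\<lambda>\<omega>. poly (chebyshev_P k) (s \<omega>)))"
  proof (rule converges_in_moments_distrI)
    show "(\<lambda>\<omega>. poly (chebyshev_P k) (s \<omega>)) \<in> borel_measurable \<Omega>"
      by (intro borel_measurable_continuous_comp continuous_intros)
    show "integrable \<Omega> (\<lambda>\<omega>. poly (chebyshev_P k) (s \<omega>) ^ m)" for m
      by (intro integrable_continuous_comp continuous_intros)
    show "(\<lambda>d. vacuum_moments (pverts (T d)) (r d) (normalized_distance_matrix d k (T d)) m)
        \<longlonglongrightarrow> expectation (\<lambda>\<omega>. poly (chebyshev_P k) (s \<omega>) ^ m)" for m
      unfolding expectation_chebyshev_P_power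
      by (intro tendsto_vacuum_moments_normalized_distance_matrix assms(1,2))
  qed
  then show ?thesis
    by (simp only: normalized_distance_matrix_def)
qed

end
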